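(* There are infinitely many rational Diophantine sextuples which contain one regular Diophantine quintuple and two regular Diophantine quadruples.
   Context: A rational Diophantine $m$-tuple is a set $\{a_1,\ldots,a_m\}$ of $m$ distinct nonzero rational numbers such that $a_ia_j+1$ is the square of a rational number for all $1\le i<j\le m$. A rational Diophantine quadruple $\{a,b,c,d\}$ is called regular if $(a+b-c-d)^2=4(ab+1)(cd+1)$. A rational Diophantine quintuple $\{a,b,c,d,e\}$ is called regular if $(abcde+2abc+a+b+c-d-e)^2=4(ab+1)(ac+1)(bc+1)(de+1)$. "Contains" means the quadruple or quintuple is a subset of the sextuple. *)

theory Defs
  imports Complex_Main
begin

definition diophantine_tuple :: "nat \<Rightarrow> rat set \<Rightarrow> bool" where
  "diophantine_tuple m S \<longleftrightarrow>
     finite S \<and> card S = m \<and> 0 \<notin> S \<and>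
     (\<forall>x\<in>S. \<forall>y\<in>S. x \<noteq> y \<longrightarrow> (\<exists>r::rat. x * y + 1 = r\<^sup>2))"

definition quadruple_eq :: "rat \<Rightarrow> rat \<Rightarrow> rat \<Rightarrow> rat \<Rightarrow> bool" where
  "quadruple_eq a b c d \<longleftrightarrow> (a + b - c - d)\<^sup>2 = 4 * (a * b + 1) * (c * d + 1)"

definition quintuple_eq :: "rat \<Rightarrow> rat \<Rightarrow> rat \<Rightarrow> rat \<Rightarrow> rat \<Rightarrow> bool" where
  "quintuple_eq a b c d e \<longleftrightarrow>
     (a * b * c * d * e + 2 * a * b * c + a + b + c - d - e)\<^sup>2 =
       4 * (a * b + 1) * (a * c + 1) * (b * c + 1) * (d * e + 1)"

text \<open>Both equations are invariant under every permutation of their arguments (the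
  transpositions of neighbouring arguments suffice).  Hence regularity is a property of the
  underlying set, and asking for some labelling of its elements below is the same as asking
  for every labelling.\<close>

lemma quadruple_eq_swaps:
  "quadruple_eq b a c d \<longleftrightarrow> quadruple_eq a b c d"
  "quadruple_eq a c b d \<longleftrightarrow> quadruple_eq a b c d"
  "quadruple_eq a b d c \<longleftrightarrow> quadruple_eq a b c d"
  unfolding quadruple_eq_def by algebra+

lemma quintuple_eq_swaps:
  "quintuple_eq b a c d e \<longleftrightarrow> quintuple_eq a b c d e"
  "quintuple_eq a c b d e \<longleftrightarrow> quintuple_eq a b c d e"
  "quintuple_eq a b d c e \<longleftrightarrow> quintuple_eq a b c d e"
  "quintuple_eq a b c e d \<longleftrightarrow> quintuple_eq a b c d e"
  unfolding quintuple_eq_def by algebra+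

definition regular_quadruple :: "rat set \<Rightarrow> bool" where
  "regular_quadruple S \<longleftrightarrow>
     diophantine_tuple 4 S \<and> (\<exists>a b c d. S = {a, b, c, d} \<and> quadruple_eq a b c d)"

definition regular_quintuple :: "rat set \<Rightarrow> bool" where
  "regular_quintuple S \<longleftrightarrow>
     diophantine_tuple 5 S \<and> (\<exists>a b c d e. S = {a, b, c, d, e} \<and> quintuple_eq a b c d e)"

end

theory Submission
  imports Defs "HOL-Computational_Algebra.Polynomial"
begin

text \<open>A triple \<open>{a, b, c}\<close> with \<open>ab + 1 = r\<^sup>2\<close> has two regular extensions \<open>d\<close> and \<open>f\<close>, and
  \<open>df + 1 = (a + b - c)\<^sup>2 - 4r\<^sup>2 + 1\<close>.  Suppose that this is a square \<open>z\<^sup>2\<close>, and let \<open>e\<close> extend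
  \<open>{a, b, d, f}\<close> to a regular quintuple; then only \<open>ce + 1\<close> may fail to be a square.  With
  \<open>r\<close>, \<open>z\<close> and \<open>a + b - c\<close> fixed, it is a quadratic polynomial in \<open>c\<close> with square leading
  coefficient, and its discriminant vanishes when \<open>z\<^sup>2(2r - 3) = 2r + 1\<close> and
  \<open>a + b - c = 2(r - 1)z\<close>.  In that case \<open>e\<close> is linear in \<open>c\<close>, and it remains to make \<open>ac + 1\<close> and
  \<open>bc + 1\<close> squares.  This condition defines a curve of genus one over the field of rational
  functions in \<open>z\<close>, an intersection of two quadrics with several evident points at which
  \<open>c\<close> is infinite; the plane through three of them meets the curve in a further point, which gives
  \<open>a\<close> and \<open>b\<close> as rational functions of \<open>z\<close>.  The six elements are distinct and nonzero for \<open>z = 3\<close>,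
  hence for all but finitely many \<open>z\<close>.\<close>

subsection \<open>Rational functions without a pole at a point\<close>

text \<open>The quotient must represent \<open>f\<close> wherever its denominator is nonzero, so
  that a nonzero value at \<open>x\<close> settles all but finitely many arguments. As
  \<open>p\<close> and \<open>q\<close> are existential, composite functions need no
  expansion.\<close>

definition regular_at :: "'a::field \<Rightarrow> ('a \<Rightarrow> 'a) \<Rightarrow> bool" where
  "regular_at x f \<longleftrightarrow>
     (\<exists>p q. poly q x \<noteq> 0 \<and> (\<forall>y. poly q y \<noteq> 0 \<longrightarrow> f y = poly p y / poly q y))"

lemma regular_atI:
  assumes "poly q x \<noteq> 0" "\<And>y. poly q y \<noteq> 0 \<Longrightarrow> f y = poly p y / poly q y"
  shows "regular_at x f"
  using assms unfolding regular_at_def by blast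

lemma regular_atE:
  assumes "regular_at x f"
  obtains p q where "poly q x \<noteq> 0" "\<And>y. poly q y \<noteq> 0 \<Longrightarrow> f y = poly p y / poly q y"
  using assms unfolding regular_at_def by blast

lemma regular_at_const: "regular_at x (\<lambda>_. c)"
  by (rule regular_atI[of 1 _ _ "[:c:]"]) auto

lemma regular_at_id: "regular_at x (\<lambda>y. y)"
  by (rule regular_atI[of 1 _ _ "[:0, 1:]"]) auto

lemma regular_at_add:
  assumes "regular_at x f" "regular_at x g"
  shows "regular_at x (\<lambda>y. f y + g y)"
proof -
  obtain p q where pq: "poly q x \<noteq> 0" "\<And>y. poly q y \<noteq> 0 \<Longrightarrow> f y = poly p y / poly q y"
    using assms(1) by (rule regular_atE) (rule that)
  obtain p' q' where pq': "poly q' x \<noteq> 0" "\<And>y. poly q' y \<noteq> 0 \<Longrightarrow> g y = poly p' y / poly q' y"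
    using assms(2) by (rule regular_atE) (rule that)
  show ?thesis
  proof (rule regular_atI)
    show "poly (q * q') x \<noteq> 0"
      using pq(1) pq'(1) by simp
    show "f y + g y = poly (p * q' + p' * q) y / poly (q * q') y" if "poly (q * q') y \<noteq> 0" for y
      using that pq(2)[of y] pq'(2)[of y] by (simp add: add_frac_eq)
  qed
qed

lemma regular_at_mult:
  assumes "regular_at x f" "regular_at x g"
  shows "regular_at x (\<lambda>y. f y * g y)"
proof -
  obtain p q where pq: "poly q x \<noteq> 0" "\<And>y. poly q y \<noteq> 0 \<Longrightarrow> f y = poly p y / poly q y"
    using assms(1) by (rule regular_atE) (rule that)
  obtain p' q' where pq': "poly q' x \<noteq> 0" "\<And>y. poly q' y \<noteq> 0 \<Longrightarrow> g y = poly p' y / poly q' y"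
    using assms(2) by (rule regular_atE) (rule that)
  show ?thesis
  proof (rule regular_atI)
    show "poly (q * q') x \<noteq> 0"
      using pq(1) pq'(1) by simp
    show "f y * g y = poly (p * p') y / poly (q * q') y" if "poly (q * q') y \<noteq> 0" for y
      using that pq(2)[of y] pq'(2)[of y] by simp
  qed
qed

lemma regular_at_inverse:
  assumes "regular_at x f" "f x \<noteq> 0"
  shows "regular_at x (\<lambda>y. inverse (f y))"
proof -
  obtain p q where pq: "poly q x \<noteq> 0" "\<And>y. poly q y \<noteq> 0 \<Longrightarrow> f y = poly p y / poly q y"
    using assms(1) by (rule regular_atE) (rule that)
  show ?thesis
  proof (rule regular_atI)
    \<comment> \<open>The extra factor \<open>q\<close> keeps the representation of \<open>f\<close>
      available wherever the new denominator is nonzero.\<close>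
    show "poly (p * q) x \<noteq> 0"
      using pq(1) pq(2)[of x] assms(2) by simp
    show "inverse (f y) = poly (q * q) y / poly (p * q) y" if "poly (p * q) y \<noteq> 0" for y
      using that pq(2)[of y] by simp
  qed
qed

lemma regular_at_diff:
  assumes "regular_at x f" "regular_at x g"
  shows "regular_at x (\<lambda>y. f y - g y)"
  using regular_at_add[OF assms(1) regular_at_mult[OF regular_at_const[of _ "-1"] assms(2)]] by simp

lemma regular_at_uminus:
  assumes "regular_at x f"
  shows "regular_at x (\<lambda>y. - f y)"
  using regular_at_diff[OF regular_at_const[of _ 0] assms] by simp

lemma regular_at_divide:
  assumes "regular_at x f" "regular_at x g" "g x \<noteq> 0"
  shows "regular_at x (\<lambda>y. f y / g y)"
  unfolding divide_inverse by (intro regular_at_mult regular_at_inverse assms)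

lemma regular_at_power:
  assumes "regular_at x f"
  shows "regular_at x (\<lambda>y. f y ^ n)"
  by (induction n) (auto intro: regular_at_const regular_at_mult assms)

lemmas regular_at_intros = regular_at_const regular_at_id regular_at_add regular_at_mult
  regular_at_diff regular_at_uminus regular_at_divide regular_at_power

lemma eventually_cofinite_imp_infinite:
  fixes P :: "'a :: semiring_char_0 \<Rightarrow> bool"
  assumes "\<forall>\<^sub>F x in cofinite. P x"
  shows "infinite {x. P x}"
proof
  assume "finite {x. P x}"
  moreover have "finite {x. \<not> P x}"
    using assms by (simp add: eventually_cofinite)
  ultimately have "finite (UNIV :: 'a set)"
    by (rule finite_subset[rotated, OF finite_UnI]) auto
  then show False
    using infinite_UNIV_char_0 by blast
qed

text \<open>Every zero of \<open>f\<close> is a root of \<open>p * q\<close>, a nonzero polynomial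
  because of its value at \<open>x\<close>.\<close>

lemma regular_at_eventually_nonzero:
  assumes "regular_at x f" "f x \<noteq> 0"
  shows "\<forall>\<^sub>F y in cofinite. f y \<noteq> 0"
proof -
  obtain p q where pq: "poly q x \<noteq> 0" "\<And>y. poly q y \<noteq> 0 \<Longrightarrow> f y = poly p y / poly q y"
    using assms(1) by (rule regular_atE) (rule that)
  have "poly (p * q) x \<noteq> 0"
    using pq assms(2) by auto
  then have "finite {y. poly (p * q) y = 0}"
    by (intro poly_roots_finite) auto
  moreover have "{y. f y = 0} \<subseteq> {y. poly (p * q) y = 0}"
    using pq(2) by force
  ultimately show ?thesis
    by (auto simp: eventually_cofinite intro: finite_subset)
qed

lemma regular_at_eventually_neq:
  assumes "regular_at x f" "regular_at x g" "f x \<noteq> g x"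
  shows "\<forall>\<^sub>F y in cofinite. f y \<noteq> g y"
  using regular_at_eventually_nonzero[OF regular_at_diff[OF assms(1,2)]] assms(3) by simp

lemma regular_at_eventually_distinct:
  assumes "\<And>g. g \<in> set gs \<Longrightarrow> regular_at x g" "distinct (map (\<lambda>g. g x) gs)"
  shows "\<forall>\<^sub>F y in cofinite. distinct (map (\<lambda>g. g y) gs)"
  using assms
proof (induction gs)
  case (Cons g gs)
  have "\<forall>\<^sub>F y in cofinite. \<forall>h\<in>set gs. g y \<noteq> h y"
    using Cons.prems by (intro eventually_ball_finite ballI regular_at_eventually_neq) auto
  moreover have "\<forall>\<^sub>F y in cofinite. distinct (map (\<lambda>g. g y) gs)"
    using Cons by simp
  ultimately show ?case
    by eventually_elim auto
qed simp

subsection \<open>Sextuples from triples\<close>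

lemma diophantine_tuple_set:
  assumes "distinct (0 # xs)" "sorted_wrt (\<lambda>x y. \<exists>q. x * y + 1 = q\<^sup>2) xs"
  shows "diophantine_tuple (length xs) (set xs)"
  using assms by (induction xs) (auto simp: diophantine_tuple_def mult.commute)

lemma diophantine_tuple_subset:
  assumes "diophantine_tuple m S" "T \<subseteq> S" "card T = n"
  shows "diophantine_tuple n T"
  using assms unfolding diophantine_tuple_def by (meson finite_subset subset_iff)

lemma sextuple_criterion:
  fixes a b c d e f r s t z :: rat
  assumes ab: "a * b + 1 = r\<^sup>2" and ac: "a * c + 1 = s\<^sup>2" and bc: "b * c + 1 = t\<^sup>2"
    and z: "z\<^sup>2 * (2 * r - 3) = 2 * r + 1" and r: "r \<noteq> 0"
    and c: "c = a + b - 2 * (r - 1) * z"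
    and d: "d = a + b + c + 2 * a * b * c + 2 * r * s * t"
    and f: "f = a + b + c + 2 * a * b * c - 2 * r * s * t"
    and e: "e = (2 * r - 3) * ((2 * r + 1) * c + 2 * z)"
    and dist: "distinct [0, a, b, c, d, f, e]"
  shows "diophantine_tuple 6 {a, b, c, d, f, e}"
    and "regular_quintuple {a, b, d, f, e}"
    and "regular_quadruple {a, b, c, d}"
    and "regular_quadruple {a, b, c, f}"
proof -
  \<comment> \<open>\<open>d\<close> and \<open>f\<close> are the two roots of
    \<open>quadruple_eq a b c\<close>, exchanged by changing the sign of \<open>r\<close>; the
    square roots below correspond likewise, up to sign.\<close>
  have ad: "a * d + 1 = (a * t + r * s)\<^sup>2" and bd: "b * d + 1 = (b * s + r * t)\<^sup>2"
    and cd: "c * d + 1 = (c * r + s * t)\<^sup>2"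
    using ab ac bc unfolding d by algebra+
  have af: "a * f + 1 = (a * t - r * s)\<^sup>2" and bf: "b * f + 1 = (b * s - r * t)\<^sup>2"
    and cf: "c * f + 1 = (c * r - s * t)\<^sup>2"
    using ab ac bc unfolding f by algebra+
  \<comment> \<open>Product of the roots by Vieta; \<open>sum\<close> below is the sum of the
    roots.\<close>
  have "d * f + 1 = (a + b - c)\<^sup>2 - 4 * r\<^sup>2 + 1"
    using ab ac bc unfolding d f by algebra
  \<comment> \<open>\<open>4 * (r - 1)\<^sup>2 - 1 = (2 * r - 3) * (2 * r - 1)\<close> brings in the
    relation for \<open>z\<close>.\<close>
  also have "\<dots> = z\<^sup>2"
    using c z by algebra
  finally have df: "d * f + 1 = z\<^sup>2" .
  have sum: "d + f = 4 * (r - 1) * z + 4 * r\<^sup>2 * c"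
    using c unfolding d f ab[symmetric] by algebra
  \<comment> \<open>With \<open>k = (2 * r - 3) * z\<close> the relation gives
    \<open>e = k * (k * c + 2)\<close>, whence \<open>ce\<close>. For \<open>ae\<close> and
    \<open>be\<close>, \<open>c\<close> and \<open>ab\<close> make \<open>a * c\<close> and
    \<open>b * c\<close> quadratics in \<open>a\<close> and \<open>b\<close> alone, and the square
    is completed.\<close>
  have ae: "a * e + 1 = ((2 * r - 3) * z * a - 2 * r\<^sup>2 + r + 2)\<^sup>2"
    using e c ab z by algebra
  have be: "b * e + 1 = ((2 * r - 3) * z * b - 2 * r\<^sup>2 + r + 2)\<^sup>2"
    using e c ab z by algebra
  have ce: "c * e + 1 = ((2 * r - 3) * z * c + 1)\<^sup>2"
    using e z by algebra
  \<comment> \<open>The factor \<open>4 * r\<^sup>2\<close> lets \<open>sum\<close> replace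
    \<open>c\<close> by \<open>d + f\<close>; then \<open>df\<close> leaves a quadratic in
    \<open>d\<close>. The case of \<open>f\<close> is symmetric.\<close>
  have de: "d * e + 1 = (((2 * r - 3) * z * d / 2 + r + 1) / r)\<^sup>2"
  proof -
    have "4 * r\<^sup>2 * (d * e + 1) = ((2 * r - 3) * z * d + 2 * r + 2)\<^sup>2"
      using e sum df z by algebra
    then show ?thesis using r by (simp add: field_simps power2_eq_square)
  qed
  have fe: "f * e + 1 = (((2 * r - 3) * z * f / 2 + r + 1) / r)\<^sup>2"
  proof -
    have "4 * r\<^sup>2 * (f * e + 1) = ((2 * r - 3) * z * f + 2 * r + 2)\<^sup>2"
      using e sum df z by algebra
    then show ?thesis using r by (simp add: field_simps power2_eq_square)
  qed
  have "sorted_wrt (\<lambda>x y. \<exists>q. x * y + 1 = q\<^sup>2) [a, b, c, d, f, e]"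
    by (simp only: sorted_wrt.simps list.set ball_simps simp_thms)
      (intro conjI; rule exI, fact ab ac bc ad bd cd af bf cf df ae be ce de fe)
  with dist show dio: "diophantine_tuple 6 {a, b, c, d, f, e}"
    using diophantine_tuple_set[of "[a, b, c, d, f, e]"] by (simp add: numeral_eq_Suc)
  have "quadruple_eq a b c d" "quadruple_eq a b c f"
    unfolding quadruple_eq_def d f using ab ac bc by algebra+
  moreover have "diophantine_tuple 4 {a, b, c, d}" "diophantine_tuple 4 {a, b, c, f}"
    using dist by (auto intro!: diophantine_tuple_subset[OF dio])
  ultimately show "regular_quadruple {a, b, c, d}" "regular_quadruple {a, b, c, f}"
    unfolding regular_quadruple_def by blast+
  \<comment> \<open>Compare square roots: up to the factor \<open>2 * r\<close>, the base on the
    left is the product of a root of \<open>4 * r\<^sup>2 * (a * d + 1) * (b * d + 1)\<close> and a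
    root of \<open>4 * r\<^sup>2 * (f * e + 1)\<close>.\<close>
  have "quintuple_eq a b d f e"
  proof -
    have "4 * r\<^sup>2 * ((a * d + 1) * (b * d + 1)) = ((2 * r\<^sup>2 - 1) * d + 2 * (r - 1) * z)\<^sup>2"
      using c ab sum df z by algebra
    moreover have "2 * r * (a * b * d * f * e + 2 * a * b * d + a + b + d - f - e) =
        ((2 * r\<^sup>2 - 1) * d + 2 * (r - 1) * z) * ((2 * r - 3) * z * f + 2 * r + 2)"
    proof -
      have "2 * (a * b * d * f * e + 2 * a * b * d + a + b + d - f - e)
        = 2 * (((r\<^sup>2 - 1) * (z\<^sup>2 - 1) - 1) * e + (2 * r\<^sup>2 - 1) * d - f + c + 2 * (r - 1) * z)"
        using ab df c by algebra
      then show ?thesis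
        using e sum df z by algebra
    qed
    ultimately have "(2 * r)\<^sup>2 * (a * b * d * f * e + 2 * a * b * d + a + b + d - f - e)\<^sup>2 =
        4 * r\<^sup>2 * ((a * d + 1) * (b * d + 1)) * ((2 * r - 3) * z * f + 2 * r + 2)\<^sup>2"
      by (simp only: power_mult_distrib[symmetric])
    also have "((2 * r - 3) * z * f + 2 * r + 2)\<^sup>2 = 4 * r\<^sup>2 * (f * e + 1)"
      unfolding fe using r by (simp add: field_simps power2_eq_square)
    finally show ?thesis
      unfolding quintuple_eq_def using r ab by (simp add: power2_eq_square)
  qed
  moreover have "diophantine_tuple 5 {a, b, d, f, e}"
    using dist by (auto intro!: diophantine_tuple_subset[OF dio])
  ultimately show "regular_quintuple {a, b, d, f, e}"
    unfolding regular_quintuple_def by blast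
qed

subsection \<open>A one-parameter family\<close>

text \<open>The relation between \<open>r\<close> and \<open>z\<close> is linear in
  \<open>r\<close>; this is its solution.\<close>

definition fam_r :: "rat \<Rightarrow> rat" where
  "fam_r z = (3 * z\<^sup>2 + 1) / (2 * (z\<^sup>2 - 1))"

text \<open>Since \<open>a * b = r\<^sup>2 - 1\<close> is fixed by \<open>z\<close>, one unknown
  remains; \<open>fam_X / fam_V\<close> is, up to a simple factor, the value of \<open>b\<close> at
  the point found on the curve of genus one.\<close>

definition fam_V :: "rat \<Rightarrow> rat" where
  "fam_V z = (z\<^sup>2 + 3) * (7 * z ^ 4 + 10 * z\<^sup>2 - 1) * (3 * z\<^sup>2 + 1)\<^sup>2"

definition fam_X :: "rat \<Rightarrow> rat" where
  "fam_X z = 4 * z ^ 14 - 433 * z ^ 12 - 1590 * z ^ 10 - 1679 * z ^ 8 - 352 * z ^ 6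
     - 95 * z ^ 4 + 50 * z\<^sup>2 - 1"

definition fam_a :: "rat \<Rightarrow> rat" where
  "fam_a z = - (z * (5 * z\<^sup>2 - 1) * (z\<^sup>2 + 3) * fam_V z) / ((z\<^sup>2 - 1) * fam_X z)"

definition fam_b :: "rat \<Rightarrow> rat" where
  "fam_b z = - fam_X z / (4 * z * (z\<^sup>2 - 1) * fam_V z)"

definition fam_c :: "rat \<Rightarrow> rat" where
  "fam_c z = fam_a z + fam_b z - 2 * (fam_r z - 1) * z"

text \<open>Changing the sign of this root of \<open>a * c + 1\<close>, or of \<open>fam_t\<close>,
  would only exchange \<open>fam_d\<close> and \<open>fam_f\<close>.\<close>

definition fam_s :: "rat \<Rightarrow> rat" where
  "fam_s z = (3 * z\<^sup>2 + 1) * (24 * z ^ 14 - 297 * z ^ 12 - 1418 * z ^ 10 - 2079 * z ^ 8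
     - 820 * z ^ 6 + 553 * z ^ 4 - 58 * z\<^sup>2 - 1) / (2 * (z\<^sup>2 - 1) * fam_X z)"

definition fam_t :: "rat \<Rightarrow> rat" where
  "fam_t z = - (32 * z ^ 14 + 601 * z ^ 12 + 1618 * z ^ 10 + 1215 * z ^ 8 + 380 * z ^ 6
     + 263 * z ^ 4 - 14 * z\<^sup>2 + 1) / (4 * z * (z\<^sup>2 - 1) * fam_V z)"

definition fam_d :: "rat \<Rightarrow> rat" where
  "fam_d z = fam_a z + fam_b z + fam_c z + 2 * fam_a z * fam_b z * fam_c z
     + 2 * fam_r z * fam_s z * fam_t z"

definition fam_f :: "rat \<Rightarrow> rat" where
  "fam_f z = fam_a z + fam_b z + fam_c z + 2 * fam_a z * fam_b z * fam_c z
     - 2 * fam_r z * fam_s z * fam_t z"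

definition fam_e :: "rat \<Rightarrow> rat" where
  "fam_e z = (2 * fam_r z - 3) * ((2 * fam_r z + 1) * fam_c z + 2 * z)"

section \<open>Identities for the triple of the family\<close>

lemma fam_ab:
  assumes "z \<noteq> 0" "z\<^sup>2 - 1 \<noteq> 0" "fam_V z \<noteq> 0" "fam_X z \<noteq> 0"
  shows "fam_a z * fam_b z + 1 = (fam_r z)\<^sup>2"
proof -
  have "fam_a z * fam_b z = (5 * z\<^sup>2 - 1) * (z\<^sup>2 + 3) / (4 * (z\<^sup>2 - 1)\<^sup>2)"
    unfolding fam_a_def fam_b_def using assms by (simp add: divide_simps) (simp add: power2_eq_square)
  also have "\<dots> + 1 = (fam_r z)\<^sup>2"
    unfolding fam_r_def power_divide using assms(2) by (simp add: divide_simps) algebra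
  finally show ?thesis .
qed

lemma fam_ac:
  assumes "z \<noteq> 0" "z\<^sup>2 - 1 \<noteq> 0" "fam_V z \<noteq> 0" "fam_X z \<noteq> 0"
  shows "fam_a z * fam_c z + 1 = (fam_s z)\<^sup>2"
proof -
  define A where "A = z * (5 * z\<^sup>2 - 1) * (z\<^sup>2 + 3) * fam_V z"
  define S where "S = (3 * z\<^sup>2 + 1) * (24 * z ^ 14 - 297 * z ^ 12 - 1418 * z ^ 10
    - 2079 * z ^ 8 - 820 * z ^ 6 + 553 * z ^ 4 - 58 * z\<^sup>2 - 1)"
  have a: "fam_a z = - A / ((z\<^sup>2 - 1) * fam_X z)" and s: "fam_s z = S / (2 * (z\<^sup>2 - 1) * fam_X z)"
    unfolding fam_a_def A_def fam_s_def S_def by (rule refl)+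
  have w: "2 * (fam_r z - 1) * z = (z\<^sup>2 + 3) * z / (z\<^sup>2 - 1)"
    unfolding fam_r_def using assms(2) by (simp add: field_simps)
  \<comment> \<open>The equation \<open>a\<^sup>2 + r\<^sup>2 - a * w = s\<^sup>2\<close> with
    \<open>w = 2 * (r - 1) * z\<close>, cleared of denominators.\<close>
  have "4 * A\<^sup>2 + 4 * A * (z\<^sup>2 + 3) * z * fam_X z + (3 * z\<^sup>2 + 1)\<^sup>2 * (fam_X z)\<^sup>2 = S\<^sup>2"
    unfolding A_def S_def fam_V_def fam_X_def by algebra
  moreover have "fam_a z * fam_c z + 1 = (fam_a z)\<^sup>2 + (fam_r z)\<^sup>2 - fam_a z * (2 * (fam_r z - 1) * z)"
    unfolding fam_c_def using fam_ab[OF assms] by algebra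
  ultimately show ?thesis
    unfolding w unfolding a s fam_r_def using assms(2,4)
    by (simp add: divide_simps) algebra
qed

lemma fam_bc:
  assumes "z \<noteq> 0" "z\<^sup>2 - 1 \<noteq> 0" "fam_V z \<noteq> 0" "fam_X z \<noteq> 0"
  shows "fam_b z * fam_c z + 1 = (fam_t z)\<^sup>2"
proof -
  define E where "E = 4 * z * (z\<^sup>2 - 1) * fam_V z"
  define T where "T = 32 * z ^ 14 + 601 * z ^ 12 + 1618 * z ^ 10 + 1215 * z ^ 8 + 380 * z ^ 6
     + 263 * z ^ 4 - 14 * z\<^sup>2 + 1"
  have E: "E \<noteq> 0"
    using assms by (simp add: E_def)
  have b: "fam_b z * E = - fam_X z" and t: "fam_t z * E = - T"
    using E unfolding fam_b_def fam_t_def E_def T_def by simp_all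
  have "2 * (z\<^sup>2 - 1) * fam_r z = 3 * z\<^sup>2 + 1"
    unfolding fam_r_def using assms(2) by simp
  then have r: "E * fam_r z = 2 * z * fam_V z * (3 * z\<^sup>2 + 1)"
    unfolding E_def by algebra
  have w: "E * (2 * (fam_r z - 1) * z) = 4 * z\<^sup>2 * fam_V z * (z\<^sup>2 + 3)"
    using r unfolding E_def by algebra
  have "(fam_X z)\<^sup>2 + 4 * fam_X z * (z\<^sup>2 + 3) * z\<^sup>2 * fam_V z
      + 4 * z\<^sup>2 * (3 * z\<^sup>2 + 1)\<^sup>2 * (fam_V z)\<^sup>2 = T\<^sup>2"
    unfolding T_def fam_V_def fam_X_def by algebra
  moreover have "E\<^sup>2 * (fam_b z * fam_c z + 1) =
      (fam_b z * E)\<^sup>2 + (E * fam_r z)\<^sup>2 - fam_b z * E * (E * (2 * (fam_r z - 1) * z))"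
    unfolding fam_c_def using fam_ab[OF assms] by algebra
  ultimately have "E\<^sup>2 * (fam_b z * fam_c z + 1) = (fam_t z * E)\<^sup>2"
    unfolding b r w t by algebra
  then show ?thesis
    using E by (simp add: power_mult_distrib)
qed

lemma fam_r_relation:
  assumes "z\<^sup>2 - 1 \<noteq> 0"
  shows "z\<^sup>2 * (2 * fam_r z - 3) = 2 * fam_r z + 1"
  unfolding fam_r_def using assms by (simp add: field_simps)

section \<open>Nondegeneracy for all but finitely many parameters\<close>

lemma regular_at_fam:
  "regular_at 3 fam_r" "regular_at 3 fam_V" "regular_at 3 fam_X" "regular_at 3 fam_a"
  "regular_at 3 fam_b" "regular_at 3 fam_c" "regular_at 3 fam_s" "regular_at 3 fam_t"
  "regular_at 3 fam_d" "regular_at 3 fam_e" "regular_at 3 fam_f"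
proof -
  have V: "fam_V 3 \<noteq> 0" and X: "fam_X 3 \<noteq> 0"
    by (simp_all add: fam_V_def fam_X_def)
  show r: "regular_at 3 fam_r"
    unfolding fam_r_def[abs_def] by (intro regular_at_intros) simp
  show rV: "regular_at 3 fam_V" and rX: "regular_at 3 fam_X"
    unfolding fam_V_def[abs_def] fam_X_def[abs_def] by (intro regular_at_intros)+
  show a: "regular_at 3 fam_a" and s: "regular_at 3 fam_s"
    unfolding fam_a_def[abs_def] fam_s_def[abs_def]
    by (intro regular_at_intros rV rX; use X in simp)+
  show b: "regular_at 3 fam_b" and t: "regular_at 3 fam_t"
    unfolding fam_b_def[abs_def] fam_t_def[abs_def]
    by (intro regular_at_intros rV rX; use V in simp)+
  show c: "regular_at 3 fam_c"
    unfolding fam_c_def[abs_def] by (intro regular_at_intros r a b)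
  show "regular_at 3 fam_d" "regular_at 3 fam_e" "regular_at 3 fam_f"
    unfolding fam_d_def[abs_def] fam_e_def[abs_def] fam_f_def[abs_def]
    by (intro regular_at_intros r a b c s t)+
qed

lemma fam_distinct_at_3:
  "distinct [0, fam_a 3, fam_b 3, fam_c 3, fam_d 3, fam_f 3, fam_e 3]"
proof -
  have r: "fam_r 3 = 7 / 4" and V: "fam_V 3 = 6171648" and X: "fam_X 3 = - 316149760"
    by (simp_all add: fam_r_def fam_V_def fam_X_def)
  have a: "fam_a 3 = 596673 / 154370" and b: "fam_b 3 = 77185 / 144648"
    by (simp_all add: fam_a_def fam_b_def V X)
  have c: "fam_c 3 = - 1129649183 / 11164655880"
    by (simp add: fam_c_def a b r)
  \<comment> \<open>Only the product of \<open>s\<close> and \<open>t\<close> enters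
    \<open>d\<close> and \<open>f\<close>.\<close>
  have s: "fam_s 3 * fam_t 3 = - 4842093313 / 6379803360"
    by (simp add: fam_s_def fam_t_def V X)
  have "fam_d 3 = 94464 / 77185" "fam_f 3 = 77185 / 11808"
    unfolding fam_d_def fam_f_def mult.assoc s by (simp_all add: a b c r)
  moreover have "fam_e 3 = 13756558657 / 4962069280"
    by (simp add: fam_e_def c r)
  ultimately show ?thesis
    by (simp add: a b c)
qed

lemma infinite_fam_admissible:
  "infinite {z. z \<noteq> 0 \<and> z\<^sup>2 - 1 \<noteq> 0 \<and> fam_V z \<noteq> 0 \<and> fam_X z \<noteq> 0 \<and>
     distinct [0, fam_a z, fam_b z, fam_c z, fam_d z, fam_f z, fam_e z]}"
proof -
  have "\<forall>\<^sub>F z in cofinite. z \<noteq> (0 :: rat)"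
    using regular_at_eventually_nonzero[OF regular_at_id, of "3 :: rat"] by simp
  moreover have "regular_at 3 (\<lambda>z :: rat. z\<^sup>2 - 1)"
    by (intro regular_at_intros)
  then have "\<forall>\<^sub>F z in cofinite. z\<^sup>2 - 1 \<noteq> (0 :: rat)"
    by (rule regular_at_eventually_nonzero) simp
  moreover have "\<forall>\<^sub>F z in cofinite. fam_V z \<noteq> 0"
    using regular_at_fam(2) by (rule regular_at_eventually_nonzero) (simp add: fam_V_def)
  moreover have "\<forall>\<^sub>F z in cofinite. fam_X z \<noteq> 0"
    using regular_at_fam(3) by (rule regular_at_eventually_nonzero) (simp add: fam_X_def)
  moreover have "\<forall>\<^sub>F z in cofinite. distinct [0, fam_a z, fam_b z, fam_c z, fam_d z, fam_f z, fam_e z]"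
  proof -
    let ?gs = "[\<lambda>_. 0, fam_a, fam_b, fam_c, fam_d, fam_f, fam_e]"
    have "regular_at 3 g" if "g \<in> set ?gs" for g
      using that by (auto simp only: list.set insert_iff empty_iff regular_at_fam regular_at_const)
    moreover have "distinct (map (\<lambda>g. g 3) ?gs)"
      unfolding list.map by (rule fam_distinct_at_3)
    ultimately have "\<forall>\<^sub>F z in cofinite. distinct (map (\<lambda>g. g z) ?gs)"
      by (rule regular_at_eventually_distinct)
    then show ?thesis
      unfolding list.map .
  qed
  ultimately show ?thesis
    by (intro eventually_cofinite_imp_infinite eventually_conj)
qed

text \<open>The value \<open>r\<^sup>2 = ab + 1\<close> can be read off the sextuple up to finitely many choices, and it
  determines \<open>z\<close> up to finitely many choices.\<close>

lemma finite_fam_r_fibre: "finite {z. z\<^sup>2 - 1 \<noteq> 0 \<and> (fam_r z)\<^sup>2 = v}"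
proof -
  define p where "p = [:1, 0, 3:]\<^sup>2 - smult (4 * v) ([:-1, 0, 1:]\<^sup>2)"
  \<comment> \<open>The second summand of \<open>p\<close> vanishes at 1 for every \<open>v\<close>,
    leaving 16.\<close>
  have "poly p 1 \<noteq> 0"
    by (simp add: p_def)
  then have "finite {z. poly p z = 0}"
    by (intro poly_roots_finite) auto
  moreover have "{z. z\<^sup>2 - 1 \<noteq> 0 \<and> (fam_r z)\<^sup>2 = v} \<subseteq> {z. poly p z = 0}"
  proof clarify
    fix z assume z: "z\<^sup>2 - 1 \<noteq> 0" and v: "v = (fam_r z)\<^sup>2"
    have "4 * (z\<^sup>2 - 1)\<^sup>2 * (fam_r z)\<^sup>2 = (3 * z\<^sup>2 + 1)\<^sup>2"
      unfolding fam_r_def power_divide power_mult_distrib using z by simp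
    then show "poly p z = 0"
      by (simp add: p_def v power2_eq_square algebra_simps)
  qed
  ultimately show ?thesis
    by (rule finite_subset[rotated])
qed

section \<open>Infinitely many sextuples\<close>

theorem theorem1:
  "infinite {S :: rat set. diophantine_tuple 6 S \<and>
     (\<exists>P. P \<subseteq> S \<and> regular_quintuple P) \<and>
     (\<exists>Q R. Q \<subseteq> S \<and> R \<subseteq> S \<and> Q \<noteq> R \<and> regular_quadruple Q \<and> regular_quadruple R)}"
  (is "infinite ?T")
proof
  define A where "A = {z. z \<noteq> 0 \<and> z\<^sup>2 - 1 \<noteq> 0 \<and> fam_V z \<noteq> 0 \<and> fam_X z \<noteq> 0 \<and>
    distinct [0, fam_a z, fam_b z, fam_c z, fam_d z, fam_f z, fam_e z]}"
  define F where "F z = {fam_a z, fam_b z, fam_c z, fam_d z, fam_f z, fam_e z}" for z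
  assume "finite ?T"
  moreover have "F ` A \<subseteq> ?T"
  proof (rule image_subsetI)
    fix z assume "z \<in> A"
    then have z: "z \<noteq> 0" "z\<^sup>2 - 1 \<noteq> 0" "fam_V z \<noteq> 0" "fam_X z \<noteq> 0"
      and dist: "distinct [0, fam_a z, fam_b z, fam_c z, fam_d z, fam_f z, fam_e z]"
      by (simp_all add: A_def)
    have "fam_r z \<noteq> 0"
      using z(2) by (simp add: fam_r_def add_nonneg_eq_0_iff)
    note sextuple = sextuple_criterion[OF fam_ab[OF z] fam_ac[OF z] fam_bc[OF z]
        fam_r_relation[OF z(2)] this fam_c_def fam_d_def fam_f_def fam_e_def dist]
    have "fam_d z \<notin> {fam_a z, fam_b z, fam_c z, fam_f z}"
      using dist by auto
    then have "{fam_a z, fam_b z, fam_c z, fam_d z} \<noteq> {fam_a z, fam_b z, fam_c z, fam_f z}"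
      by blast
    moreover have "{fam_a z, fam_b z, fam_d z, fam_f z, fam_e z} \<subseteq> F z"
      "{fam_a z, fam_b z, fam_c z, fam_d z} \<subseteq> F z" "{fam_a z, fam_b z, fam_c z, fam_f z} \<subseteq> F z"
      by (auto simp: F_def)
    moreover have "diophantine_tuple 6 (F z)"
      unfolding F_def by (rule sextuple)
    ultimately show "F z \<in> ?T"
      using sextuple(2-4) by blast
  qed
  ultimately have "finite (F ` A)"
    by (rule finite_subset[rotated])
  \<comment> \<open>Finitely many sextuples would force an infinite fibre of \<open>F\<close>. But
    on a fibre \<open>(fam_r z)\<^sup>2 - 1\<close> is a product of two elements of the fixed finite
    set \<open>F z0\<close>, which leaves finitely many \<open>z\<close>.\<close>
  then obtain z0 where "infinite {z \<in> A. F z = F z0}"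
    using pigeonhole_infinite infinite_fam_admissible unfolding A_def by blast
  moreover have "{z \<in> A. F z = F z0} \<subseteq>
      (\<Union>x\<in>F z0. \<Union>y\<in>F z0. {z. z\<^sup>2 - 1 \<noteq> 0 \<and> (fam_r z)\<^sup>2 = x * y + 1})"
  proof
    fix z assume "z \<in> {z \<in> A. F z = F z0}"
    then have z: "z \<noteq> 0" "z\<^sup>2 - 1 \<noteq> 0" "fam_V z \<noteq> 0" "fam_X z \<noteq> 0" and "F z = F z0"
      by (simp_all add: A_def)
    then have "fam_a z \<in> F z0" "fam_b z \<in> F z0"
      by (auto simp: F_def)
    with fam_ab[OF z] z(2)
    show "z \<in> (\<Union>x\<in>F z0. \<Union>y\<in>F z0. {z. z\<^sup>2 - 1 \<noteq> 0 \<and> (fam_r z)\<^sup>2 = x * y + 1})"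
      by force
  qed
  moreover have "finite (F z0)"
    by (simp add: F_def)
  ultimately show False
    using finite_fam_r_fibre by (meson finite_UN_I finite_subset)
qed

end
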